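(* Let $X=(x_1,\dots,x_p)\in\mathbb R^{n\times p}$ be a matrix, $\widehat S\subset\{1,\dots,p\}$ and $\lambda_j>0$. For any $1\le j\le p$, the hybrid orthogonalization residual $z_j$ defined in the context satisfies $$z_j=x_j-X_{-j}\widehat\pi^{(j)}_{-j},$$ where $\widehat\pi^{(j)}_{-j}$ is the minimizer of the partially penalized regression problem $$\widehat\pi^{(j)}_{-j}=\arg\min_{b_{-j}}\Big\{(2n)^{-1}\|x_j-X_{-j}b_{-j}\|_2^2+\lambda_j\sum_{k\in\widehat S^c\setminus\{j\}}v_{jk}|b_k|\Big\},$$ with $\lambda_j$ and $v_{jk}$ the same as those in the definition of $z_j$.
   Context: $X_{-j}$ is the submatrix of $X$ with column $j$ removed, $b_{-j}=(b_k)_{k\ne j}\in\mathbb R^{p-1}$, and $\widehat S^c=\{1,\dots,p\}\setminus\widehat S$. For an index set $A$, $X_A$ is the submatrix of $X$ with columns in $A$, and $P_A=X_A(X_A^\top X_A)^{-1}X_A^\top$ is the projection onto its column space ($P_\emptyset=0$); $X_{\widehat S\setminus\{j\}}$ is assumed to have full column rank so that the inverse exists. For $k\in\{j\}\cup\widehat S^c$ let $\psi_k^{(j)}=(I_n-P_{\widehat S\setminus\{j\}})x_k$ and $v_{jk}=\|\psi_k^{(j)}\|_2/\sqrt n$; let $\psi^{(j)}_{\widehat S^c\setminus\{j\}}$ be the matrix with columns $\psi_k^{(j)}$, $k\in\widehat S^c\setminus\{j\}$. The hybrid orthogonalization residual is $$z_j=\psi_j^{(j)}-\psi^{(j)}_{\widehat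 S^c\setminus\{j\}}\widehat\omega_j,\qquad \widehat\omega_j=\arg\min_{b_{\widehat S^c\setminus\{j\}}}\Big\{(2n)^{-1}\big\|\psi_j^{(j)}-\psi^{(j)}_{\widehat S^c\setminus\{j\}}b_{\widehat S^c\setminus\{j\}}\big\|_2^2+\lambda_j\sum_{k\in\widehat S^c\setminus\{j\}}v_{jk}|b_k|\Big\}.$$ When a minimizer is not unique, $\widehat\omega_j$ and $\widehat\pi^{(j)}_{-j}$ denote arbitrary minimizers of their respective problems. *)

theory Defs
  imports "HOL-Analysis.Analysis" "HOL-Library.FuncSet"
begin

text \<open>
  The index set \<open>{1, \<dots>, p}\<close> is the finite type \<open>'p\<close> and \<open>n = CARD('n)\<close>. Objects indexed by a set
  \<open>A\<close> of columns are families over \<open>A\<close>: a matrix with columns in \<open>A\<close> is a family of vectors in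
  \<open>real^'n\<close>, a square matrix with rows and columns in \<open>A\<close> is a binary function of which only the
  values on \<open>A\<close> matter, and \<open>A \<rightarrow>\<^sub>E UNIV\<close> is the coefficient space of real vectors indexed by \<open>A\<close>.
\<close>

definition cols_mult :: "'p set \<Rightarrow> ('p \<Rightarrow> real^'n) \<Rightarrow> ('p \<Rightarrow> real) \<Rightarrow> real^'n" where
  "cols_mult A f b = (\<Sum>k\<in>A. b k *\<^sub>R f k)"

definition full_column_rank :: "real^'p^'n \<Rightarrow> 'p set \<Rightarrow> bool" where
  "full_column_rank X A \<longleftrightarrow> dim ((\<lambda>k. column k X) ` A) = card A"

definition is_inverse_on :: "'p set \<Rightarrow> ('p \<Rightarrow> 'p \<Rightarrow> real) \<Rightarrow> ('p \<Rightarrow> 'p \<Rightarrow> real) \<Rightarrow> bool" where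
  "is_inverse_on A M N \<longleftrightarrow>
     (\<forall>k\<in>A. \<forall>l\<in>A. (\<Sum>m\<in>A. M k m * N m l) = (if k = l then 1 else 0) \<and>
                  (\<Sum>m\<in>A. N k m * M m l) = (if k = l then 1 else 0))"

text \<open>If \<open>M\<close> is invertible, the entries of the following on \<open>A\<close> are uniquely determined.\<close>

definition inverse_on :: "'p set \<Rightarrow> ('p \<Rightarrow> 'p \<Rightarrow> real) \<Rightarrow> 'p \<Rightarrow> 'p \<Rightarrow> real" where
  "inverse_on A M = (SOME N. is_inverse_on A M N)"

text \<open>
  The matrix \<open>P\<^sub>A = X\<^sub>A (X\<^sub>A\<^sup>T X\<^sub>A)\<^sup>-\<^sup>1 X\<^sub>A\<^sup>T\<close>; note that \<open>X\<^sub>A\<^sup>T X\<^sub>A\<close> is the block of \<open>X\<^sup>T X\<close> with rows and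
  columns in \<open>A\<close>.
\<close>

definition proj_mat :: "real^'p^'n \<Rightarrow> 'p set \<Rightarrow> real^'n^'n" where
  "proj_mat X A =
     (\<chi> i m. \<Sum>k\<in>A. \<Sum>l\<in>A. X $ i $ k * inverse_on A (\<lambda>k l. (transpose X ** X) $ k $ l) k l * X $ m $ l)"

definition psi :: "real^'p^'n \<Rightarrow> 'p set \<Rightarrow> 'p \<Rightarrow> 'p \<Rightarrow> real^'n" where
  "psi X S j k = (mat 1 - proj_mat X (S - {j})) *v column k X"

definition vweight :: "real^'p^'n \<Rightarrow> 'p set \<Rightarrow> 'p \<Rightarrow> 'p \<Rightarrow> real" where
  "vweight X S j k = norm (psi X S j k) / sqrt (real CARD('n))"

definition hybrid_objective ::
    "real^'p^'n \<Rightarrow> 'p set \<Rightarrow> real \<Rightarrow> 'p \<Rightarrow> ('p \<Rightarrow> real) \<Rightarrow> real" where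
  "hybrid_objective X S lam j b =
     (norm (psi X S j j - cols_mult (- S - {j}) (psi X S j) b))\<^sup>2 / (2 * real CARD('n))
     + lam * (\<Sum>k\<in>- S - {j}. vweight X S j k * \<bar>b k\<bar>)"

definition is_hybrid_minimizer ::
    "real^'p^'n \<Rightarrow> 'p set \<Rightarrow> real \<Rightarrow> 'p \<Rightarrow> ('p \<Rightarrow> real) \<Rightarrow> bool" where
  "is_hybrid_minimizer X S lam j \<omega> \<longleftrightarrow>
     is_arg_min (hybrid_objective X S lam j) (\<lambda>b. b \<in> (- S - {j}) \<rightarrow>\<^sub>E UNIV) \<omega>"

definition hybrid_residual :: "real^'p^'n \<Rightarrow> 'p set \<Rightarrow> 'p \<Rightarrow> ('p \<Rightarrow> real) \<Rightarrow> real^'n" where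
  "hybrid_residual X S j \<omega> = psi X S j j - cols_mult (- S - {j}) (psi X S j) \<omega>"

definition partial_objective ::
    "real^'p^'n \<Rightarrow> 'p set \<Rightarrow> real \<Rightarrow> 'p \<Rightarrow> ('p \<Rightarrow> real) \<Rightarrow> real" where
  "partial_objective X S lam j b =
     (norm (column j X - cols_mult (- {j}) (\<lambda>k. column k X) b))\<^sup>2 / (2 * real CARD('n))
     + lam * (\<Sum>k\<in>- S - {j}. vweight X S j k * \<bar>b k\<bar>)"

definition is_partial_minimizer ::
    "real^'p^'n \<Rightarrow> 'p set \<Rightarrow> real \<Rightarrow> 'p \<Rightarrow> ('p \<Rightarrow> real) \<Rightarrow> bool" where
  "is_partial_minimizer X S lam j \<pi> \<longleftrightarrow>
     is_arg_min (partial_objective X S lam j) (\<lambda>b. b \<in> (- {j}) \<rightarrow>\<^sub>E UNIV) \<pi>"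

end

theory Submission
  imports Defs
begin

text \<open>
  Write \<open>A = S - {j}\<close> and \<open>Q = I - P\<^sub>A\<close>. A coefficient vector on the unselected columns extends to all
  columns other than \<open>j\<close> by letting its coefficients on \<open>A\<close> fit the projection onto the span of
  \<open>X\<^sub>A\<close>; the residual of the extension is the hybrid residual and the penalty does not change. For
  an arbitrary coefficient vector with residual \<open>r\<close>, its restriction has hybrid residual \<open>Q r\<close>, which
  is not longer than \<open>r\<close>. Hence the extension of a hybrid minimizer is a partial minimizer, and all
  partial minimizers share one residual because the squared norm is strictly convex.
\<close>

section \<open>Full column rank and invertibility of the Gram block\<close>

text \<open>The rank is the dimension of a set of vectors, so repeated columns must be excluded
  first. The chain dim <= card of the image <= \<open>card A\<close> is tight, which makes the
  indexing injective and the image independent; a relation between indices then becomes a relation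
  between vectors.\<close>

lemma full_column_rank_zero_combination:
  fixes X :: "real^'p^'n"
  assumes "full_column_rank X A" and "cols_mult A (\<lambda>k. column k X) b = 0" and "k \<in> A"
  shows "b k = 0"
proof -
  let ?f = "\<lambda>k. column k X"
  have d: "dim (?f ` A) = card A" using assms(1) by (simp add: full_column_rank_def)
  have "dim (?f ` A) \<le> card (?f ` A)" by (rule dim_le_card) (auto intro: span_base)
  with d have inj: "inj_on ?f A"
    by (metis card_image_le eq_card_imp_inj_on finite order_antisym)
  have ind: "independent (?f ` A)"
    by (rule card_le_dim_spanning[where V = "?f ` A"])
       (auto simp: d card_image_le intro: span_base)
  have inv: "inv_into A ?f (?f k) = k" if "k \<in> A" for k
    using inj that by (rule inv_into_f_f)
  define u where "u v = b (inv_into A ?f v)" for v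
  have "(\<Sum>v\<in>?f ` A. u v *\<^sub>R v) = (\<Sum>k\<in>A. b k *\<^sub>R ?f k)"
    using inj by (simp add: sum.reindex u_def inv)
  then have "(\<Sum>v\<in>?f ` A. u v *\<^sub>R v) = 0"
    using assms(2) by (simp add: cols_mult_def)
  then have "u (?f k) = 0"
    using ind assms(3) by (auto simp: independent_explicit_finite_subsets)
  then show ?thesis using assms(3) by (simp add: u_def inv)
qed

lemma gram_entry: "(transpose X ** X) $ k $ l = column k X \<bullet> column l (X :: real^'p^'n)"
  by (simp add: matrix_matrix_mult_def transpose_def column_def inner_vec_def)

text \<open>
  Padding the Gram block with an identity block gives a square matrix over the whole index type,
  to which the library theory of invertible matrices applies.
\<close>

lemma is_inverse_on_gram:
  fixes X :: "real^'p^'n"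
  assumes "full_column_rank X A"
  shows "is_inverse_on A (\<lambda>k l. (transpose X ** X) $ k $ l)
           (inverse_on A (\<lambda>k l. (transpose X ** X) $ k $ l))"
proof -
  let ?G = "\<lambda>k l. column k X \<bullet> column l X"
  define M :: "real^'p^'p" where
    "M = (\<chi> k l. if k \<in> A \<and> l \<in> A then ?G k l else if k = l then 1 else 0)"
  have Mv: "(M *v v) $ k = (if k \<in> A then \<Sum>l\<in>A. ?G k l * v $ l else v $ k)" for v k
  proof -
    have "(M *v v) $ k = (\<Sum>l\<in>UNIV. M $ k $ l * v $ l)"
      by (simp add: matrix_vector_mult_def)
    also have "\<dots> = (if k \<in> A then \<Sum>l\<in>A. ?G k l * v $ l else v $ k)"
    proof (cases "k \<in> A")
      case True
      then have "(\<Sum>l\<in>UNIV. M $ k $ l * v $ l) = (\<Sum>l\<in>A. M $ k $ l * v $ l)"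
        by (intro sum.mono_neutral_right) (auto simp: M_def)
      with True show ?thesis by (simp add: M_def)
    next
      case False
      then have "(\<Sum>l\<in>UNIV. M $ k $ l * v $ l) = (\<Sum>l\<in>{k}. M $ k $ l * v $ l)"
        by (intro sum.mono_neutral_right) (auto simp: M_def)
      with False show ?thesis by (simp add: M_def)
    qed
    finally show ?thesis .
  qed
  \<comment> \<open>Off \<open>A\<close>, \<open>M\<close> acts as the identity. On
    \<open>A\<close>, the equation says that the combination of columns with coefficients
    \<open>v\<close> is orthogonal to each column in \<open>A\<close>, hence to itself, so it
    vanishes.\<close>
  have "v = 0" if "M *v v = 0" for v
  proof -
    let ?w = "cols_mult A (\<lambda>k. column k X) (($) v)"
    have orth: "column k X \<bullet> ?w = 0" if "k \<in> A" for k
      using Mv[of v k] that \<open>M *v v = 0\<close>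
      by (simp add: cols_mult_def inner_sum_right mult.commute)
    have "?w \<bullet> ?w = (\<Sum>k\<in>A. v $ k * (column k X \<bullet> ?w))"
      by (subst cols_mult_def) (simp add: inner_sum_left)
    then have "?w = 0" by (simp add: orth)
    then have "v $ k = 0" if "k \<in> A" for k
      using full_column_rank_zero_combination[OF assms] that by blast
    moreover have "v $ k = 0" if "k \<notin> A" for k
      using Mv[of v k] that \<open>M *v v = 0\<close> by simp
    ultimately show ?thesis by (metis vec_eq_iff zero_index)
  qed
  then obtain N where N: "N ** M = mat 1"
    using matrix_left_invertible_ker by metis
  then have N': "M ** N = mat 1" by (simp add: matrix_left_right_inverse)
  \<comment> \<open>Entries of \<open>M\<close> linking \<open>A\<close> to its complement are 0, so
    the sums in \<open>M ** N\<close> and \<open>N ** M\<close> collapse to sums over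
    \<open>A\<close>.\<close>
  have "is_inverse_on A (\<lambda>k l. (transpose X ** X) $ k $ l) (\<lambda>k l. N $ k $ l)"
    unfolding is_inverse_on_def
  proof (intro ballI conjI)
    fix k l assume kl: "k \<in> A" "l \<in> A"
    have "(\<Sum>m\<in>A. (transpose X ** X) $ k $ m * N $ m $ l) = (\<Sum>m\<in>UNIV. M $ k $ m * N $ m $ l)"
      by (rule sum.mono_neutral_cong_left) (use kl in \<open>auto simp: M_def gram_entry\<close>)
    also have "\<dots> = (M ** N) $ k $ l" by (simp add: matrix_matrix_mult_def)
    finally show "(\<Sum>m\<in>A. (transpose X ** X) $ k $ m * N $ m $ l) = (if k = l then 1 else 0)"
      by (simp add: N' mat_def)
    have "(\<Sum>m\<in>A. N $ k $ m * (transpose X ** X) $ m $ l) = (\<Sum>m\<in>UNIV. N $ k $ m * M $ m $ l)"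
      by (rule sum.mono_neutral_cong_left) (use kl in \<open>auto simp: M_def gram_entry\<close>)
    also have "\<dots> = (N ** M) $ k $ l" by (simp add: matrix_matrix_mult_def)
    finally show "(\<Sum>m\<in>A. N $ k $ m * (transpose X ** X) $ m $ l) = (if k = l then 1 else 0)"
      by (simp add: N mat_def)
  qed
  then show ?thesis unfolding inverse_on_def by (metis someI)
qed

section \<open>The projection and its residual\<close>

text \<open>Explicit coefficients place the projected vector in the span of the columns in
  \<open>A\<close>; the extension of a hybrid coefficient vector later reuses them.\<close>

lemma proj_mat_mult:
  fixes X :: "real^'p^'n"
  shows "proj_mat X A *v y = cols_mult A (\<lambda>k. column k X)
    (\<lambda>k. \<Sum>l\<in>A. inverse_on A (\<lambda>k l. (transpose X ** X) $ k $ l) k l * (column l X \<bullet> y))"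
proof -
  let ?N = "inverse_on A (\<lambda>k l. (transpose X ** X) $ k $ l)"
  have "(proj_mat X A *v y) $ i =
      (\<Sum>k\<in>A. (\<Sum>l\<in>A. ?N k l * (column l X \<bullet> y)) * X $ i $ k)" for i
  proof -
    have "(proj_mat X A *v y) $ i =
        (\<Sum>m\<in>UNIV. \<Sum>k\<in>A. \<Sum>l\<in>A. X $ i $ k * ?N k l * X $ m $ l * y $ m)"
      by (simp add: matrix_vector_mult_def proj_mat_def sum_distrib_right)
    also have "\<dots> = (\<Sum>k\<in>A. \<Sum>l\<in>A. \<Sum>m\<in>UNIV. X $ i $ k * ?N k l * X $ m $ l * y $ m)"
      by (subst sum.swap, rule sum.cong[OF refl], rule sum.swap)
    also have "\<dots> = (\<Sum>k\<in>A. (\<Sum>l\<in>A. ?N k l * (column l X \<bullet> y)) * X $ i $ k)"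
      by (simp add: inner_vec_def column_def sum_distrib_left sum_distrib_right mult_ac)
    finally show ?thesis .
  qed
  then show ?thesis by (simp add: vec_eq_iff cols_mult_def column_def)
qed

text \<open>These are the normal equations: the Gram block cancels against its inverse.\<close>

lemma column_inner_proj_mat:
  fixes X :: "real^'p^'n"
  assumes "full_column_rank X A" and "m \<in> A"
  shows "column m X \<bullet> (proj_mat X A *v y) = column m X \<bullet> y"
proof -
  let ?N = "inverse_on A (\<lambda>k l. (transpose X ** X) $ k $ l)"
  let ?G = "\<lambda>k l. column k X \<bullet> column l X"
  have inv: "(\<Sum>k\<in>A. ?G m k * ?N k l) = (if m = l then 1 else 0)" if "l \<in> A" for l
    using is_inverse_on_gram[OF assms(1)] assms(2) that
    unfolding is_inverse_on_def gram_entry by blast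
  have "column m X \<bullet> (proj_mat X A *v y) = (\<Sum>k\<in>A. \<Sum>l\<in>A. ?G m k * ?N k l * (column l X \<bullet> y))"
    by (simp add: proj_mat_mult cols_mult_def inner_sum_right sum_distrib_right sum_distrib_left
        mult_ac)
  also have "\<dots> = (\<Sum>l\<in>A. (\<Sum>k\<in>A. ?G m k * ?N k l) * (column l X \<bullet> y))"
    by (subst sum.swap) (simp add: sum_distrib_right)
  also have "\<dots> = (\<Sum>l\<in>A. if m = l then column l X \<bullet> y else 0)"
    by (rule sum.cong) (auto simp: inv)
  also have "\<dots> = column m X \<bullet> y" using assms(2) by simp
  finally show ?thesis .
qed

lemma cols_mult_orthogonal_residual:
  fixes X :: "real^'p^'n"
  assumes "full_column_rank X A"
  shows "cols_mult A (\<lambda>k. column k X) b \<bullet> ((mat 1 - proj_mat X A) *v y) = 0"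
  by (simp add: cols_mult_def inner_sum_left inner_diff_right matrix_vector_mult_diff_rdistrib
      column_inner_proj_mat[OF assms])

text \<open>Pythagoras for the orthogonal splitting of \<open>y\<close> into its projection and its
  residual.\<close>

lemma norm_residual_le:
  fixes X :: "real^'p^'n"
  assumes "full_column_rank X A"
  shows "norm ((mat 1 - proj_mat X A) *v y) \<le> norm y"
proof -
  let ?q = "(mat 1 - proj_mat X A) *v y" and ?p = "proj_mat X A *v y"
  have "?p \<bullet> ?q = 0"
    unfolding proj_mat_mult by (rule cols_mult_orthogonal_residual[OF assms])
  moreover have "y = ?p + ?q" by (simp add: matrix_vector_mult_diff_rdistrib)
  ultimately have "(norm y)\<^sup>2 = (norm ?p)\<^sup>2 + (norm ?q)\<^sup>2"
    by (metis norm_add_Pythagorean orthogonal_def)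
  then show ?thesis by (simp add: power2_le_imp_le)
qed

text \<open>The residual is orthogonal both to the column and to its projection, hence to their
  difference, which is the residual itself.\<close>

lemma residual_column_eq_0:
  fixes X :: "real^'p^'n"
  assumes "full_column_rank X A" and "k \<in> A"
  shows "(mat 1 - proj_mat X A) *v column k X = 0"
proof -
  let ?q = "(mat 1 - proj_mat X A) *v column k X"
  have "column k X \<bullet> ?q = 0"
    using column_inner_proj_mat[OF assms]
    by (simp add: matrix_vector_mult_diff_rdistrib inner_diff_right)
  moreover have "(proj_mat X A *v column k X) \<bullet> ?q = 0"
    unfolding proj_mat_mult by (rule cols_mult_orthogonal_residual[OF assms(1)])
  ultimately have "(column k X - proj_mat X A *v column k X) \<bullet> ?q = 0"
    by (simp add: inner_diff_left)
  then show ?thesis by (simp add: matrix_vector_mult_diff_rdistrib)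
qed

section \<open>Passing between the hybrid and the partial problem\<close>

lemma cols_mult_split:
  fixes f :: "'p::finite \<Rightarrow> real^'n"
  shows "cols_mult (- {j}) f b = cols_mult (S - {j}) f b + cols_mult (- S - {j}) f b"
proof -
  have "- {j} = (S - {j}) \<union> (- S - {j})" by auto
  then show ?thesis
    unfolding cols_mult_def by (metis (no_types, lifting) Diff_disjoint Diff_eq
        Int_Diff Int_empty_left finite inf_commute inf_compl_bot sum.union_disjoint)
qed

lemma residual_cols_mult:
  fixes X :: "real^'p^'n"
  shows "(mat 1 - proj_mat X (S - {j})) *v
           (column j X - cols_mult (- S - {j}) (\<lambda>k. column k X) b) = hybrid_residual X S j b"
  by (simp add: hybrid_residual_def psi_def cols_mult_def matrix_vector_mult_diff_distrib
      linear_sum[OF matrix_vector_mul_linear] matrix_vector_mult_scaleR)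

text \<open>Multiplication by \<open>?Q\<close> annihilates the selected columns, so their
  coefficients have no effect on the right-hand side.\<close>

lemma hybrid_residual_eq_residual:
  fixes X :: "real^'p^'n"
  assumes "full_column_rank X (S - {j})"
  shows "hybrid_residual X S j b = (mat 1 - proj_mat X (S - {j})) *v
           (column j X - cols_mult (- {j}) (\<lambda>k. column k X) b)"
proof -
  let ?Q = "mat 1 - proj_mat X (S - {j})"
  have "?Q *v cols_mult (S - {j}) (\<lambda>k. column k X) b = 0"
    by (simp add: cols_mult_def linear_sum[OF matrix_vector_mul_linear]
        matrix_vector_mult_scaleR residual_column_eq_0[OF assms])
  then show ?thesis
    unfolding residual_cols_mult[symmetric] cols_mult_split[of j _ b S]
    by (simp add: matrix_vector_mult_diff_distrib matrix_vector_right_distrib)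
qed

text \<open>Projecting shortens the residual, and both penalties are the same sum. The
  \<open>restrict\<close> only makes \<open>b\<close> a member of the hybrid coefficient
  space.\<close>

lemma hybrid_objective_restrict_le:
  fixes X :: "real^'p^'n"
  assumes "full_column_rank X (S - {j})"
  shows "hybrid_objective X S lam j (restrict b (- S - {j})) \<le> partial_objective X S lam j b"
proof -
  have "norm (hybrid_residual X S j b) \<le> norm (column j X - cols_mult (- {j}) (\<lambda>k. column k X) b)"
    unfolding hybrid_residual_eq_residual[OF assms] by (rule norm_residual_le[OF assms])
  then show ?thesis
    by (auto simp: hybrid_objective_def partial_objective_def hybrid_residual_def cols_mult_def
        intro!: divide_right_mono power_mono)
qed

lemma hybrid_extension:
  fixes X :: "real^'p^'n"
  obtains c where "c \<in> (- {j}) \<rightarrow>\<^sub>E UNIV"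
    and "column j X - cols_mult (- {j}) (\<lambda>k. column k X) c = hybrid_residual X S j b"
    and "partial_objective X S lam j c = hybrid_objective X S lam j b"
proof -
  let ?y = "column j X - cols_mult (- S - {j}) (\<lambda>k. column k X) b"
  \<comment> \<open>The vector \<open>?y\<close> is what the unselected columns leave of column
    \<open>j\<close>; \<open>a\<close> regresses it on the selected ones.\<close>
  obtain a where a: "proj_mat X (S - {j}) *v ?y = cols_mult (S - {j}) (\<lambda>k. column k X) a"
    using proj_mat_mult by blast
  define c where "c = restrict (\<lambda>k. if k \<in> S then a k else b k) (- {j})"
  have 1: "cols_mult (S - {j}) (\<lambda>k. column k X) c = cols_mult (S - {j}) (\<lambda>k. column k X) a"
    unfolding cols_mult_def by (rule sum.cong) (auto simp: c_def)
  have 2: "cols_mult (- S - {j}) (\<lambda>k. column k X) c = cols_mult (- S - {j}) (\<lambda>k. column k X) b"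
    unfolding cols_mult_def by (rule sum.cong) (auto simp: c_def)
  have res: "column j X - cols_mult (- {j}) (\<lambda>k. column k X) c = hybrid_residual X S j b"
    unfolding residual_cols_mult[symmetric] cols_mult_split[of j _ c S] 1 2 a[symmetric]
      matrix_vector_mult_diff_rdistrib
    by (simp add: algebra_simps)
  have "(\<Sum>k\<in>- S - {j}. vweight X S j k * \<bar>c k\<bar>) = (\<Sum>k\<in>- S - {j}. vweight X S j k * \<bar>b k\<bar>)"
    by (rule sum.cong) (auto simp: c_def)
  with res have "partial_objective X S lam j c = hybrid_objective X S lam j b"
    by (simp add: partial_objective_def hybrid_objective_def hybrid_residual_def)
  moreover have "c \<in> (- {j}) \<rightarrow>\<^sub>E UNIV" by (simp add: c_def)
  ultimately show ?thesis using that res by blast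
qed

section \<open>Uniqueness of the residual\<close>

text \<open>A form of the parallelogram law; the last term quantifies strict convexity.\<close>

lemma norm_midpoint_sq:
  fixes u v :: "'a::real_inner"
  shows "(norm ((1/2) *\<^sub>R (u + v)))\<^sup>2 = ((norm u)\<^sup>2 + (norm v)\<^sup>2) / 2 - (norm (u - v))\<^sup>2 / 4"
  by (simp add: power2_norm_eq_inner inner_add_left inner_add_right inner_diff_left
      inner_diff_right inner_commute field_simps)

text \<open>Minimizers may differ, but their midpoint would have a strictly smaller objective if
  their residuals did.\<close>

lemma partial_minimizer_residual_unique:
  fixes X :: "real^'p^'n"
  assumes "lam \<ge> 0" and b: "is_partial_minimizer X S lam j b" and c: "is_partial_minimizer X S lam j c"
  shows "column j X - cols_mult (- {j}) (\<lambda>k. column k X) b =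
         column j X - cols_mult (- {j}) (\<lambda>k. column k X) c"
proof -
  let ?r = "\<lambda>b. column j X - cols_mult (- {j}) (\<lambda>k. column k X) b"
  let ?F = "partial_objective X S lam j"
  let ?pen = "\<lambda>b. \<Sum>k\<in>- S - {j}. vweight X S j k * \<bar>b k\<bar>"
  let ?n = "real CARD('n)"
  define m where "m = restrict (\<lambda>k. (b k + c k) / 2) (- {j})"
  have m: "m \<in> (- {j}) \<rightarrow>\<^sub>E UNIV" by (simp add: m_def)
  have le: "?F b \<le> ?F m" "?F c \<le> ?F m"
    using b c m unfolding is_partial_minimizer_def is_arg_min_linorder by blast+
  have "cols_mult (- {j}) (\<lambda>k. column k X) m =
      (1/2) *\<^sub>R (cols_mult (- {j}) (\<lambda>k. column k X) b + cols_mult (- {j}) (\<lambda>k. column k X) c)"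
    by (simp add: cols_mult_def m_def scaleR_sum_right sum.distrib[symmetric]
        scaleR_add_left[symmetric] add_divide_distrib)
  then have "?r m = (1/2) *\<^sub>R (?r b + ?r c)"
    by (simp add: vec_eq_iff field_simps)
  then have rm: "(norm (?r m))\<^sup>2 = ((norm (?r b))\<^sup>2 + (norm (?r c))\<^sup>2) / 2 - (norm (?r b - ?r c))\<^sup>2 / 4"
    by (simp only: norm_midpoint_sq)
  have "?pen m \<le> (\<Sum>k\<in>- S - {j}. (vweight X S j k * \<bar>b k\<bar> + vweight X S j k * \<bar>c k\<bar>) / 2)"
  proof (rule sum_mono)
    fix k assume "k \<in> - S - {j}"
    then have "\<bar>m k\<bar> \<le> (\<bar>b k\<bar> + \<bar>c k\<bar>) / 2" by (simp add: m_def)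
    moreover have "vweight X S j k \<ge> 0" by (simp add: vweight_def)
    ultimately have "vweight X S j k * \<bar>m k\<bar> \<le> vweight X S j k * ((\<bar>b k\<bar> + \<bar>c k\<bar>) / 2)"
      by (rule mult_left_mono)
    then show "vweight X S j k * \<bar>m k\<bar> \<le> (vweight X S j k * \<bar>b k\<bar> + vweight X S j k * \<bar>c k\<bar>) / 2"
      by (simp add: algebra_simps)
  qed
  also have "\<dots> = (?pen b + ?pen c) / 2"
    by (simp add: sum_divide_distrib[symmetric] sum.distrib)
  finally have "lam * ?pen m \<le> lam * ((?pen b + ?pen c) / 2)"
    using assms(1) by (rule mult_left_mono)
  then have pen: "lam * ?pen m \<le> (lam * ?pen b + lam * ?pen c) / 2"
    by (simp add: algebra_simps)
  \<comment> \<open>The factor 8 is the 4 of the midpoint identity times the 2 of the loss.\<close>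
  have "(norm (?r m))\<^sup>2 / (2 * ?n) =
      ((norm (?r b))\<^sup>2 / (2 * ?n) + (norm (?r c))\<^sup>2 / (2 * ?n)) / 2 - (norm (?r b - ?r c))\<^sup>2 / (8 * ?n)"
    unfolding rm by (simp add: field_simps)
  with pen have "?F m \<le> (?F b + ?F c) / 2 - (norm (?r b - ?r c))\<^sup>2 / (8 * ?n)"
    unfolding partial_objective_def by argo
  with le have "(norm (?r b - ?r c))\<^sup>2 / (8 * ?n) \<le> 0" by argo
  then have "(norm (?r b - ?r c))\<^sup>2 \<le> 0" by (simp add: divide_le_0_iff)
  then show ?thesis by simp
qed

theorem proposition1:
  fixes X :: "real^'p^'n" and S :: "'p set" and j :: 'p and lam :: real
    and \<omega> \<pi> :: "'p \<Rightarrow> real"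
  assumes "lam > 0"
    and "full_column_rank X (S - {j})"
    and "is_hybrid_minimizer X S lam j \<omega>"
    and "is_partial_minimizer X S lam j \<pi>"
  shows "hybrid_residual X S j \<omega> = column j X - cols_mult (- {j}) (\<lambda>k. column k X) \<pi>"
proof -
  obtain c where c: "c \<in> (- {j}) \<rightarrow>\<^sub>E UNIV"
    and res: "column j X - cols_mult (- {j}) (\<lambda>k. column k X) c = hybrid_residual X S j \<omega>"
    and obj: "partial_objective X S lam j c = hybrid_objective X S lam j \<omega>"
    by (rule hybrid_extension)
  \<comment> \<open>The minimal hybrid value bounds the partial objective from below everywhere, and
    \<open>c\<close> attains it.\<close>
  have "partial_objective X S lam j c \<le> partial_objective X S lam j b" for b
  proof -
    have "restrict b (- S - {j}) \<in> (- S - {j}) \<rightarrow>\<^sub>E UNIV" by simp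
    then have "hybrid_objective X S lam j \<omega> \<le> hybrid_objective X S lam j (restrict b (- S - {j}))"
      using assms(3) unfolding is_hybrid_minimizer_def is_arg_min_linorder by blast
    also have "\<dots> \<le> partial_objective X S lam j b"
      by (rule hybrid_objective_restrict_le[OF assms(2)])
    finally show ?thesis by (simp add: obj)
  qed
  with c have "is_partial_minimizer X S lam j c"
    by (simp add: is_partial_minimizer_def is_arg_min_linorder)
  from partial_minimizer_residual_unique[OF _ this assms(4)] assms(1) res
  show ?thesis by simp
qed

end
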